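(* Let $n\ge 2$ be an integer, let $\mathfrak{A}$ be a $2$-torsion free unital ring and let $M_r(\mathfrak{A})$ be the ring of $r\times r$ matrices over $\mathfrak{A}$ with $r\geq 2$. Then for every multiplicative generalized Jordan $n$-derivation $\Delta:M_r(\mathfrak{A})\rightarrow M_r(\mathfrak{A})$ there exist $\mu\in\mathcal{Z}(\mathfrak{A})$ and a derivation $\delta:M_r(\mathfrak{A})\rightarrow M_r(\mathfrak{A})$ such that $\Delta(t)=\mu t+\delta(t)$ for all $t\in M_r(\mathfrak{A})$.
   Context: Rings are associative with identity; $\mathcal{Z}(\mathfrak{A})$ is the center of $\mathfrak{A}$. A ring is $2$-torsion free if $2t=0$ implies $t=0$. For $\mu\in\mathcal{Z}(\mathfrak{A})$ and a matrix $t$, $\mu t$ denotes entrywise multiplication by $\mu$. In a ring $R$ the Jordan product is $t_1\circ t_2=t_1t_2+t_2t_1$. Set $q_1(t_1)=t_1$ and $q_n(t_1,\ldots,t_n)=q_{n-1}(t_1,\ldots,t_{n-1})\circ t_n$ for $n\ge 2$. A map $\delta:R\to R$ (not assumed additive) is a multiplicative Jordan $n$-derivation if $\delta(q_n(t_1,\ldots,t_n))=\sum_{i=1}^n q_n(t_1,\ldots,t_{i-1},\delta(t_i),t_{i+1},\ldots,t_n)$ for all $t_1,\ldots,t_n\in R$. A map $\Delta:R\to R$ (not assumed additive) is a multiplicative generalized Jordan $n$-derivation if there exists a multiplicative Jordan $n$-derivation $\delta:R\to R$ (not assumed additive) such that $\Delta(q_n(t_1,\ldots,t_n))=q_n(\Delta(t_1),t_2,\ldots,t_n)+\sum_{i=2}^n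 q_n(t_1,\ldots,t_{i-1},\delta(t_i),t_{i+1},\ldots,t_n)$ for all $t_1,\ldots,t_n\in R$. A derivation is an additive map $d$ with $d(t_1t_2)=d(t_1)t_2+t_1d(t_2)$ for all $t_1,t_2$. *)

theory Defs
  imports "HOL-Analysis.Finite_Cartesian_Product"
begin

text \<open>
  The vector type already carries the componentwise product, so square matrices are wrapped in a
  type of their own to obtain a ring under matrix multiplication.  A unital ring is given by the
  sort \<open>{ring, monoid_mult}\<close>: unlike \<open>ring_1\<close> (and hence unlike the library product \<open>**\<close>, which
  requires \<open>semiring_1\<close>) this does not impose \<open>0 \<noteq> 1\<close>, so the zero ring is included.
\<close>

typedef ('a, 'n) sqmat = "UNIV :: ('a ^ 'n ^ 'n) set"
  morphisms mat_of Sqmat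
  by blast

setup_lifting type_definition_sqmat

instantiation sqmat :: (ring, finite) ring
begin

lift_definition zero_sqmat :: "('a, 'b) sqmat" is 0 .
lift_definition plus_sqmat :: "('a, 'b) sqmat \<Rightarrow> ('a, 'b) sqmat \<Rightarrow> ('a, 'b) sqmat" is "(+)" .
lift_definition minus_sqmat :: "('a, 'b) sqmat \<Rightarrow> ('a, 'b) sqmat \<Rightarrow> ('a, 'b) sqmat" is "(-)" .
lift_definition uminus_sqmat :: "('a, 'b) sqmat \<Rightarrow> ('a, 'b) sqmat" is uminus .
lift_definition times_sqmat :: "('a, 'b) sqmat \<Rightarrow> ('a, 'b) sqmat \<Rightarrow> ('a, 'b) sqmat"
  is "\<lambda>A B. \<chi> i j. \<Sum>k\<in>UNIV. A $ i $ k * B $ k $ j" .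

instance
proof
  fix A B C :: "('a, 'b) sqmat"
  show "A * B * C = A * (B * C)"
  proof (transfer, clarsimp simp: vec_eq_iff sum_distrib_left sum_distrib_right mult.assoc)
    fix A B C :: "'a ^ 'b ^ 'b" and i j
    show "(\<Sum>k\<in>UNIV. \<Sum>l\<in>UNIV. A $ i $ l * (B $ l $ k * C $ k $ j)) =
          (\<Sum>l\<in>UNIV. \<Sum>k\<in>UNIV. A $ i $ l * (B $ l $ k * C $ k $ j))"
      by (rule sum.swap)
  qed
qed (transfer; simp add: vec_eq_iff algebra_simps sum.distrib)+

end

instantiation sqmat :: ("{ring, monoid_mult}", finite) monoid_mult
begin

lift_definition one_sqmat :: "('a, 'b) sqmat" is "\<chi> i j. if i = j then 1 else 0" .

instance
  by standard (transfer; simp add: vec_eq_iff if_distrib[where f = "\<lambda>x. x * _"]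
    if_distrib[where f = "\<lambda>x. _ * x"] cong: if_cong)+

end

lemma mat_of_times: "mat_of (A * B) = mat_of A ** mat_of B"
  for A B :: "('a :: ring_1, 'n :: finite) sqmat"
  by transfer (simp add: matrix_matrix_mult_def)

lift_definition smult_sqmat :: "'a :: times \<Rightarrow> ('a, 'n :: finite) sqmat \<Rightarrow> ('a, 'n) sqmat"
  is "\<lambda>\<mu> A. (\<chi> i j. \<mu> * A $ i $ j) :: 'a ^ 'n ^ 'n" .

definition ring_center :: "'a :: ring set"
  where "ring_center = {z. \<forall>x. z * x = x * z}"

definition jordan_prod :: "'a :: ring \<Rightarrow> 'a \<Rightarrow> 'a"
  where "jordan_prod x y = x * y + y * x"

text \<open>
  A tuple \<open>(t\<^sub>1, \<dots>, t\<^sub>n)\<close> is represented by a function on \<open>nat\<close> of which only the values at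
  \<open>1, \<dots>, n\<close> matter; the value for \<open>n = 0\<close> is a dummy.
\<close>

fun jordan_q :: "nat \<Rightarrow> (nat \<Rightarrow> 'a :: ring) \<Rightarrow> 'a" where
  "jordan_q 0 t = 0"
| "jordan_q (Suc 0) t = t 1"
| "jordan_q (Suc (Suc n)) t = jordan_prod (jordan_q (Suc n) t) (t (Suc (Suc n)))"

definition mult_jordan_derivation :: "nat \<Rightarrow> ('a :: ring \<Rightarrow> 'a) \<Rightarrow> bool"
  where "mult_jordan_derivation n \<delta> \<longleftrightarrow>
    (\<forall>t. \<delta> (jordan_q n t) = (\<Sum>i=1..n. jordan_q n (t(i := \<delta> (t i)))))"

definition mult_gen_jordan_derivation :: "nat \<Rightarrow> ('a :: ring \<Rightarrow> 'a) \<Rightarrow> bool"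
  where "mult_gen_jordan_derivation n \<Delta> \<longleftrightarrow>
    (\<exists>\<delta>. mult_jordan_derivation n \<delta> \<and>
      (\<forall>t. \<Delta> (jordan_q n t) =
        jordan_q n (t(1 := \<Delta> (t 1))) + (\<Sum>i=2..n. jordan_q n (t(i := \<delta> (t i))))))"

definition derivation :: "('a :: ring \<Rightarrow> 'a) \<Rightarrow> bool"
  where "derivation d \<longleftrightarrow> additive d \<and> (\<forall>x y. d (x * y) = d x * y + x * d y)"

end

theory Submission
  imports Defs
begin

text \<open>
  The ring \<open>R = M\<^sub>r(A)\<close> enters only through the idempotent \<open>e = E\<^sub>i\<^sub>i\<close>, its complement
  \<open>f = 1 - e\<close>, the elements \<open>p = E\<^sub>i\<^sub>j\<close>, \<open>q = E\<^sub>j\<^sub>i\<close> with \<open>i \<noteq> j\<close>, which satisfy \<open>e p f q e = e\<close>, and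
  the fact that \<open>t f R e = 0\<close> forces \<open>t f = 0\<close>.  The argument is carried out in an arbitrary 2-torsion
  free unital ring \<open>R\<close> with such elements; write \<open>x \<odot> y\<close> for the Jordan
  product and \<open>\<delta>\<close> for the Jordan \<open>n\<close>-derivation that accompanies \<open>\<Delta>\<close>.

  The difference \<open>G = \<Delta> - \<delta>\<close>.  On the tuple \<open>(a, b, 1, \<dots>, 1)\<close> the two defining identities have the
  same summands from the second one on, so that \<open>G (2\<^sup>n\<^sup>-\<^sup>2 (a \<odot> b)) = 2\<^sup>n\<^sup>-\<^sup>2 (G a \<odot> b)\<close>.  The left-hand
  side is symmetric, hence \<open>G a \<odot> b = a \<odot> G b\<close>.  Putting \<open>b = 1\<close> gives \<open>2 G a = a \<odot> z\<close> with
  \<open>z = G 1\<close>; substituting this back shows that \<open>z\<close> commutes with all commutators.  In a ring with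
  enough off-diagonal elements such a \<open>z\<close> is central, and \<open>G a = z a\<close> (\<open>jordan_self_adjoint\<close>).

  Additivity of \<open>\<delta>\<close>.  The tuples \<open>(a, b, 1, \<dots>, 1)\<close> express \<open>2 \<delta> (a \<odot> b)\<close> as
  \<open>2 \<delta> a \<odot> b + 2 a \<odot> \<delta> b\<close> plus a biadditive term.  Hence \<open>S x y = \<delta> (x + y) - \<delta> x - \<delta> y\<close> satisfies
  \<open>S x y \<odot> b = S (x \<odot> b) (y \<odot> b)\<close>.  Multiplying by well chosen \<open>b\<close> kills Peirce components
  of \<open>x\<close> and \<open>y\<close>, which in the end forces \<open>S = 0\<close> (\<open>map_add\<close>).

  Structure of \<open>\<delta>\<close>.  Once \<open>\<delta>\<close> is additive, the same identities show that \<open>w = \<delta> 1\<close> satisfies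
  \<open>(n - 1) w = 0\<close> and is central.  It need not vanish: multiplication by a central \<open>w\<close> with
  \<open>(n - 1) w = 0\<close> is a Jordan \<open>n\<close>-derivation.  But \<open>x \<mapsto> \<delta> x - w x\<close> is an additive Jordan
  derivation, and such a map is a derivation of \<open>R\<close> (\<open>jordan_derivation_is_derivation\<close>).

  Altogether \<open>\<Delta> x = (z + w) x + (\<delta> x - w x)\<close>, and a central matrix is a central scalar
  (\<open>matrix_center\<close>).
\<close>

notation jordan_prod (infixl "\<odot>" 70)

section \<open>Natural multiples and the Jordan product\<close>

text \<open>
  The coefficients \<open>2\<^sup>k\<close> and \<open>n - 2\<close> that occur below act by iterated addition; this is meaningful in
  any ring and keeps them apart from ring elements.
\<close>

primrec nsmul :: "nat \<Rightarrow> 'a :: ring \<Rightarrow> 'a" where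
  "nsmul 0 x = 0"
| "nsmul (Suc k) x = x + nsmul k x"

lemma nsmul_zero [simp]: "nsmul k 0 = 0"
  by (induction k) auto

lemma nsmul_add: "nsmul k (x + y) = nsmul k x + nsmul k y"
  by (induction k) (auto simp: algebra_simps)

lemma nsmul_diff: "nsmul k (x - y) = nsmul k x - nsmul k y"
  by (induction k) (auto simp: algebra_simps)

lemma nsmul_add_left: "nsmul (j + k) x = nsmul j x + nsmul k x"
  by (induction j) (auto simp: algebra_simps)

lemma nsmul_nsmul: "nsmul j (nsmul k x) = nsmul (j * k) x"
  by (induction j) (auto simp: nsmul_add_left)

lemma nsmul_two: "nsmul 2 x = x + x"
  by (simp add: numeral_2_eq_2)

lemma nsmul_mult_left: "nsmul k x * y = nsmul k (x * y)"
  by (induction k) (auto simp: algebra_simps)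

lemma nsmul_mult_right: "x * nsmul k y = nsmul k (x * y)"
  by (induction k) (auto simp: algebra_simps)

lemma sum_const_nsmul: "finite A \<Longrightarrow> (\<Sum>i\<in>A. c) = nsmul (card A) c"
  by (induction A rule: finite_induct) auto

lemma jordan_prod_commute: "x \<odot> y = y \<odot> x"
  by (simp add: jordan_prod_def add.commute)

lemma jordan_prod_distribs:
  "(x + y) \<odot> z = x \<odot> z + y \<odot> z" "z \<odot> (x + y) = z \<odot> x + z \<odot> y"
  "(x - y) \<odot> z = x \<odot> z - y \<odot> z" "z \<odot> (x - y) = z \<odot> x - z \<odot> y"
  by (simp_all add: jordan_prod_def algebra_simps)

lemma jordan_prod_zero [simp]: "x \<odot> 0 = 0" "0 \<odot> x = 0"
  by (simp_all add: jordan_prod_def)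

lemma jordan_prod_one [simp]: "x \<odot> 1 = x + x" "1 \<odot> x = x + x"
  for x :: "'a :: {ring, monoid_mult}"
  by (simp_all add: jordan_prod_def)

lemma nsmul_jordan_left: "nsmul k x \<odot> y = nsmul k (x \<odot> y)"
  by (simp add: jordan_prod_def nsmul_mult_left nsmul_mult_right nsmul_add)

section \<open>Evaluating the Jordan polynomials on tuples of ones\<close>

lemma jordan_q_Suc: "1 \<le> n \<Longrightarrow> jordan_q (Suc n) t = jordan_q n t \<odot> t (Suc n)"
  by (cases n) auto

lemma jordan_q_cong: "(\<And>i. 1 \<le> i \<Longrightarrow> i \<le> n \<Longrightarrow> s i = t i) \<Longrightarrow> jordan_q n s = jordan_q n t"
proof (induction n)
  case (Suc n)
  then show ?case by (cases n) auto
qed simp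

text \<open>
  Since \<open>x \<odot> 1 = 2 x\<close>, every trailing \<open>1\<close> only doubles the value.
\<close>

lemma jordan_q_ones:
  fixes t :: "nat \<Rightarrow> 'a :: {ring, monoid_mult}"
  assumes "1 \<le> j" "j \<le> n" "\<And>i. j < i \<Longrightarrow> i \<le> n \<Longrightarrow> t i = 1"
  shows "jordan_q n t = nsmul (2 ^ (n - j)) (jordan_q j t)"
  using assms(2,3)
proof (induction n rule: dec_induct)
  case (step n)
  then have "jordan_q (Suc n) t = nsmul (2 ^ (n - j)) (jordan_q j t) \<odot> 1"
    using assms(1) by (simp add: jordan_q_Suc)
  then show ?case using step.hyps by (simp add: Suc_diff_le mult_2 nsmul_add_left)
qed simp

lemma jordan_q_ones_insert:
  fixes t :: "nat \<Rightarrow> 'a :: {ring, monoid_mult}"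
  assumes "1 \<le> j" "j < i" "i \<le> n" "\<And>i. j < i \<Longrightarrow> i \<le> n \<Longrightarrow> t i = 1"
  shows "jordan_q n (t(i := w)) = nsmul (2 ^ (n - Suc j)) (jordan_q j t \<odot> w)"
proof -
  obtain i' where i: "i = Suc i'" using assms(2) by (cases i) auto
  have "jordan_q i' (t(i := w)) = jordan_q i' t"
    by (rule jordan_q_cong) (auto simp: i)
  also have "\<dots> = nsmul (2 ^ (i' - j)) (jordan_q j t)"
    using assms by (intro jordan_q_ones) (auto simp: i)
  finally have "jordan_q i (t(i := w)) = nsmul (2 ^ (i' - j)) (jordan_q j t \<odot> w)"
    using assms by (simp add: i jordan_q_Suc nsmul_jordan_left)
  moreover have "jordan_q n (t(i := w)) = nsmul (2 ^ (n - i)) (jordan_q i (t(i := w)))"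
    using assms by (intro jordan_q_ones) auto
  moreover have "(n - i) + (i' - j) = n - Suc j" using assms i by simp
  ultimately show ?thesis by (simp add: nsmul_nsmul flip: power_add)
qed

lemma jordan_q_pair:
  fixes a b :: "'a :: {ring, monoid_mult}"
  assumes "n \<ge> 2"
  shows "jordan_q n ((\<lambda>_. 1)(1 := a, 2 := b)) = nsmul (2 ^ (n - 2)) (a \<odot> b)"
proof -
  have "jordan_q n ((\<lambda>_. 1)(1 := a, 2 := b))
    = nsmul (2 ^ (n - 2)) (jordan_q 2 ((\<lambda>_. 1)(1 := a, 2 := b)))"
    using assms by (intro jordan_q_ones) auto
  then show ?thesis by (simp add: numeral_2_eq_2)
qed

lemma mult_jordan_derivation_zero:
  assumes "mult_jordan_derivation n \<delta>" "n \<ge> 2"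
  shows "\<delta> 0 = 0"
proof -
  obtain k where n: "n = Suc (Suc k)" using assms(2) by (metis One_nat_def Suc_1 Suc_le_D Suc_le_mono)
  have z: "jordan_q (Suc j) t = 0" if "t 1 = 0" for t :: "nat \<Rightarrow> 'a" and j
    using that by (induction j) auto
  have "jordan_q n ((\<lambda>_. 0)(i := \<delta> 0)) = 0" if "i \<in> {1..n}" for i
  proof (cases "i = 1")
    case True
    have "jordan_q (Suc (Suc k)) ((\<lambda>_. 0)(1 := \<delta> 0)) = 0" by simp
    then show ?thesis using True by (simp only: n)
  next
    case False
    then show ?thesis unfolding n by (intro z) auto
  qed
  moreover have "\<delta> (jordan_q n (\<lambda>_. 0)) = (\<Sum>i=1..n. jordan_q n ((\<lambda>_. 0)(i := \<delta> 0)))"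
    using assms(1) by (simp add: mult_jordan_derivation_def)
  ultimately show ?thesis using z[of "\<lambda>_. 0" "Suc k"] by (simp add: n)
qed

text \<open>
  The tuple \<open>(a, b, 1, \<dots>, 1)\<close>.  For \<open>n = 2\<close> the last summand has coefficient \<open>n - 2 = 0\<close>, so the
  truncated exponent \<open>n - 3\<close> does no harm.
\<close>

lemma mult_jordan_derivation_pair:
  fixes \<delta> :: "'a :: {ring, monoid_mult} \<Rightarrow> 'a"
  assumes \<delta>: "mult_jordan_derivation n \<delta>" and n: "n \<ge> 2"
  shows "\<delta> (nsmul (2 ^ (n - 2)) (a \<odot> b)) = nsmul (2 ^ (n - 2)) (\<delta> a \<odot> b + a \<odot> \<delta> b)
    + nsmul (n - 2) (nsmul (2 ^ (n - 3)) ((a \<odot> b) \<odot> \<delta> 1))"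
proof -
  define t where "t = (\<lambda>_ :: nat. 1 :: 'a)(1 := a, 2 := b)"
  have q2: "jordan_q 2 t = a \<odot> b"
    by (simp add: t_def numeral_2_eq_2)
  have ins: "jordan_q n (t(i := \<delta> (t i))) = nsmul (2 ^ (n - 3)) ((a \<odot> b) \<odot> \<delta> 1)"
    if "i \<in> {3..n}" for i
  proof -
    have "t i = 1" using that by (simp add: t_def)
    then have "jordan_q n (t(i := \<delta> (t i))) = nsmul (2 ^ (n - Suc 2)) (jordan_q 2 t \<odot> \<delta> 1)"
      using that by (simp only:, intro jordan_q_ones_insert) (auto simp: t_def)
    then show ?thesis by (simp add: q2 numeral_3_eq_3)
  qed
  have 1: "t(1 := \<delta> (t 1)) = (\<lambda>_. 1)(1 := \<delta> a, 2 := b)"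
    and 2: "t(2 := \<delta> (t 2)) = (\<lambda>_. 1)(1 := a, 2 := \<delta> b)"
    by (auto simp: t_def)
  have "{1..n} = {1, 2} \<union> {3..n}" using n by auto
  then have "(\<Sum>i=1..n. jordan_q n (t(i := \<delta> (t i))))
    = (\<Sum>i\<in>{1, 2}. jordan_q n (t(i := \<delta> (t i)))) + (\<Sum>i=3..n. jordan_q n (t(i := \<delta> (t i))))"
    by (simp only:, intro sum.union_disjoint) auto
  also have "(\<Sum>i=3..n. jordan_q n (t(i := \<delta> (t i))))
    = (\<Sum>i=3..n. nsmul (2 ^ (n - 3)) ((a \<odot> b) \<odot> \<delta> 1))"
    by (intro sum.cong refl ins)
  also have "\<dots> = nsmul (n - 2) (nsmul (2 ^ (n - 3)) ((a \<odot> b) \<odot> \<delta> 1))"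
    by (simp add: sum_const_nsmul)
  also have "(\<Sum>i\<in>{1, 2}. jordan_q n (t(i := \<delta> (t i))))
    = nsmul (2 ^ (n - 2)) (\<delta> a \<odot> b + a \<odot> \<delta> b)"
    using jordan_q_pair[OF n, of "\<delta> a" b] jordan_q_pair[OF n, of a "\<delta> b"] 
    unfolding nsmul_add 1[symmetric] 2[symmetric] by simp
  finally show ?thesis
    using \<delta> jordan_q_pair[OF n, of a b]
    unfolding mult_jordan_derivation_def t_def[symmetric] by metis
qed

text \<open>
  The tuple \<open>(a, 1, \<dots>, 1, b)\<close> yields the same value as \<open>(a, b, 1, \<dots>, 1)\<close>, but now \<open>\<delta> 1\<close> meets \<open>a\<close>
  before \<open>b\<close>.  Comparing the two tuples is what makes \<open>\<delta> 1\<close> central.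
\<close>

lemma mult_jordan_derivation_ends:
  fixes \<delta> :: "'a :: {ring, monoid_mult} \<Rightarrow> 'a"
  assumes \<delta>: "mult_jordan_derivation n \<delta>" and n: "n \<ge> 2"
  shows "\<delta> (nsmul (2 ^ (n - 2)) (a \<odot> b)) = nsmul (2 ^ (n - 2)) (\<delta> a \<odot> b + a \<odot> \<delta> b)
    + nsmul (n - 2) (nsmul (2 ^ (n - 3)) ((a \<odot> \<delta> 1) \<odot> b))"
proof -
  obtain m where m: "n = Suc m" "1 \<le> m" using n by (cases n) auto
  define s where "s = (\<lambda>_ :: nat. 1 :: 'a)(1 := a)"
  define t where "t = s(n := b)"
  have last: "jordan_q n (u(n := c)) = jordan_q m u \<odot> c" for u and c :: 'a
  proof -
    have "jordan_q m (u(n := c)) = jordan_q m u"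
      using m by (intro jordan_q_cong) auto
    then show ?thesis using m by (simp add: jordan_q_Suc)
  qed
  have ones: "jordan_q m ((\<lambda>_. 1)(1 := c)) = nsmul (2 ^ (n - 2)) c" for c :: 'a
  proof -
    have "jordan_q m ((\<lambda>_. 1)(1 := c)) = nsmul (2 ^ (m - 1)) (jordan_q 1 ((\<lambda>_. 1)(1 := c)))"
      using m by (intro jordan_q_ones) auto
    then show ?thesis using m by (simp add: numeral_2_eq_2)
  qed
  have 1: "jordan_q n (t(1 := \<delta> (t 1))) = nsmul (2 ^ (n - 2)) (\<delta> a \<odot> b)"
  proof -
    have "t(1 := \<delta> (t 1)) = ((\<lambda>_. 1)(1 := \<delta> a))(n := b)"
      using m by (auto simp: t_def s_def)
    then show ?thesis by (simp only: last ones nsmul_jordan_left)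
  qed
  have 2: "jordan_q n (t(n := \<delta> (t n))) = nsmul (2 ^ (n - 2)) (a \<odot> \<delta> b)"
    by (simp only: t_def fun_upd_same fun_upd_upd last) (simp only: s_def ones nsmul_jordan_left)
  have ins: "jordan_q n (t(i := \<delta> (t i))) = nsmul (2 ^ (n - 3)) ((a \<odot> \<delta> 1) \<odot> b)"
    if "i \<in> {2..m}" for i
  proof -
    have "t(i := \<delta> (t i)) = (s(i := \<delta> 1))(n := b)"
      using m that by (auto simp: t_def s_def)
    then have "jordan_q n (t(i := \<delta> (t i))) = jordan_q m (s(i := \<delta> 1)) \<odot> b"
      by (simp only: last)
    moreover have "jordan_q m (s(i := \<delta> 1)) = nsmul (2 ^ (m - Suc 1)) (jordan_q 1 s \<odot> \<delta> 1)"
      using that by (intro jordan_q_ones_insert) (auto simp: s_def)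
    ultimately show ?thesis
      using m by (simp add: s_def numeral_3_eq_3 nsmul_jordan_left)
  qed
  have "{1..n} = {1, n} \<union> {2..m}" using m by auto
  then have "(\<Sum>i=1..n. jordan_q n (t(i := \<delta> (t i))))
    = (\<Sum>i\<in>{1, n}. jordan_q n (t(i := \<delta> (t i)))) + (\<Sum>i=2..m. jordan_q n (t(i := \<delta> (t i))))"
    using m by (simp only:, intro sum.union_disjoint) auto
  also have "(\<Sum>i=2..m. jordan_q n (t(i := \<delta> (t i))))
    = (\<Sum>i=2..m. nsmul (2 ^ (n - 3)) ((a \<odot> \<delta> 1) \<odot> b))"
    by (intro sum.cong refl ins)
  also have "\<dots> = nsmul (n - 2) (nsmul (2 ^ (n - 3)) ((a \<odot> \<delta> 1) \<odot> b))"
    using m by (simp add: sum_const_nsmul numeral_2_eq_2)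
  also have "(\<Sum>i\<in>{1, n}. jordan_q n (t(i := \<delta> (t i))))
    = nsmul (2 ^ (n - 2)) (\<delta> a \<odot> b + a \<odot> \<delta> b)"
    using 1 2 n by (simp add: nsmul_add)
  moreover have "jordan_q n t = nsmul (2 ^ (n - 2)) (a \<odot> b)"
    by (simp only: t_def last) (simp only: s_def ones nsmul_jordan_left)
  ultimately show ?thesis
    using \<delta> unfolding mult_jordan_derivation_def by metis
qed

section \<open>Peirce decomposition\<close>

text \<open>
  Write \<open>R\<close> for the ring.  The annihilator conditions say that the off-diagonal Peirce corners are large:
  a nonzero element of \<open>Re\<close> does not annihilate \<open>eRf\<close> from the left, and likewise for \<open>Rf\<close> and
  \<open>fRe\<close>.  The complement \<open>f\<close> is a parameter of its own in order that the locale be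
  symmetric in \<open>e\<close> and \<open>f\<close>: each statement then comes with its mirror image.
\<close>

locale peirce_ring =
  fixes e f :: "'a :: {ring, monoid_mult}"
  assumes ee: "e * e = e" and e_plus_f: "e + f = 1"
    and tf: "\<And>x :: 'a. x + x = 0 \<Longrightarrow> x = 0"
    and ann_e: "\<And>t. (\<And>x. t * e * x * f = 0) \<Longrightarrow> t * e = 0"
    and ann_f: "\<And>t. (\<And>x. t * f * x * e = 0) \<Longrightarrow> t * f = 0"
begin

lemma f_eq: "f = 1 - e"
  using e_plus_f by (simp add: algebra_simps)

lemma ef: "e * f = 0" and fe: "f * e = 0" and ff: "f * f = f"
  by (simp_all add: f_eq algebra_simps ee)

lemma idems: "e * (e * x) = e * x" "f * (f * x) = f * x" "e * (f * x) = 0" "f * (e * x) = 0"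
  by (simp_all add: ee ff ef fe flip: mult.assoc)

lemmas peirce = mult.assoc distrib_left distrib_right left_diff_distrib right_diff_distrib
  ee ef fe ff idems

lemma swap: "peirce_ring f e"
proof
  show "f * f = f" by (rule ff)
  show "f + e = 1" using e_plus_f by (simp add: add.commute)
qed (fact tf ann_f ann_e)+

lemma cancel2: "x + x = y + y \<Longrightarrow> x = y" for x y :: 'a
  using tf[of "x - y"] by (simp add: algebra_simps)

lemma pow2_cancel:
  fixes x y :: 'a
  assumes "nsmul (2 ^ k) x = nsmul (2 ^ k) y"
  shows "x = y"
proof -
  have "nsmul (2 ^ k) z = 0 \<Longrightarrow> z = 0" for z :: 'a
  proof (induction k arbitrary: z)
    case (Suc k)
    have "nsmul (2 ^ k) (z + z) = 0"
      using Suc.prems by (simp add: nsmul_add mult_2 nsmul_add_left)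
    then show ?case using Suc.IH tf by blast
  qed simp
  from this[of "x - y"] assms show ?thesis by (simp add: nsmul_diff)
qed

lemma decomp: "x = e * x * e + e * x * f + f * x * e + f * x * f"
proof -
  have "x = (e + f) * x * (e + f)" by (simp add: e_plus_f)
  then show ?thesis by (simp add: algebra_simps)
qed

lemma split_left: "x = e * x + f * x" and split_right: "x = x * e + x * f"
  by (simp_all add: e_plus_f flip: distrib_left distrib_right)

lemma jordan_f_zero:
  assumes "s \<odot> f = 0"
  shows "s * f = 0" "f * s = 0"
proof -
  have *: "s * f + f * s = 0" using assms by (simp add: jordan_prod_def)
  have "f * (s * f + f * s) * f = 0" unfolding * by simp
  then have "f * s * f + f * s * f = 0" by (simp add: peirce)
  then have z: "f * s * f = 0" by (rule tf)
  have "f * (s * f + f * s) = 0" "(s * f + f * s) * f = 0" unfolding * by simp_all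
  with z show "f * s = 0" "s * f = 0" by (simp_all add: peirce)
qed

text \<open>
  The map \<open>x \<mapsto> x \<odot> e \<odot> f\<close> is the projection onto the off-diagonal part, written with Jordan
  products only.  It therefore commutes with every operation that is compatible with them.
\<close>

lemma off_diagonal: "x \<odot> e \<odot> f = e * x * f + f * x * e"
  by (simp add: jordan_prod_def peirce)

lemma off_diagonal_zero:
  assumes "x \<odot> e \<odot> f = 0"
  shows "e * x * f = 0" "f * x * e = 0"
proof -
  have *: "e * x * f + f * x * e = 0" using assms by (simp add: off_diagonal)
  have "e * (e * x * f + f * x * e) = 0" "f * (e * x * f + f * x * e) = 0" unfolding * by simp_all
  then show "e * x * f = 0" "f * x * e = 0" by (simp_all add: peirce)
qed

text \<open>
  The first hypothesis puts \<open>s\<close> into \<open>eRe\<close>.  Then \<open>s \<odot> (e y f)\<close> is just \<open>s e y f\<close>, which is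
  off-diagonal, so the second hypothesis says that \<open>s\<close> annihilates \<open>eRf\<close>.
\<close>

lemma corner_zero:
  assumes "s \<odot> f = 0" and y: "\<And>y. s \<odot> (e * y * f) \<odot> e \<odot> f = 0"
  shows "s = 0"
proof -
  note s = jordan_f_zero[OF assms(1)]
  have "s * e * y * f = 0" for y
  proof -
    have es: "e * s = s" using split_left[of s] s by simp
    have s': "e * (s * x) = s * x" "s * (f * x) = 0" "f * (s * x) = 0" for x
      using es s by (simp_all flip: mult.assoc)
    have "e * (s \<odot> (e * y * f)) * f = 0" using off_diagonal_zero y by blast
    then show ?thesis by (simp add: jordan_prod_def peirce s s')
  qed
  then have "s * e = 0" by (rule ann_e)
  then show ?thesis using s split_right[of s] by simp
qed

text \<open>
  All off-diagonal elements are commutators, since \<open>e y f = [e, e y f]\<close>.  An element that commutes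
  with them commutes with \<open>e\<close> and \<open>f\<close>, because its off-diagonal part is annihilated by \<open>eRf\<close> and
  \<open>fRe\<close>; and it commutes with \<open>eRe\<close>, because \<open>(z c - c z) x = z (c x) - c (x z) = 0\<close> for \<open>c\<close> in
  \<open>eRe\<close> and \<open>x\<close> in \<open>eRf\<close>.
\<close>

lemma central_of_commutes_commutators:
  assumes z: "\<And>a b :: 'a. z * (a * b - b * a) = (a * b - b * a) * z"
  shows "z * x = x * z"
proof -
  have ef: "z * (e * y * f) = e * y * f * z" "z * (f * y * e) = f * y * e * z" for y
    using z[of e "e * y * f"] z[of f "f * y * e"] by (simp_all add: peirce)
  have e_left: "z * e = e * z * e"
  proof -
    have "(z * e - e * z * e) * e = 0"
    proof (rule ann_e)
      fix x show "(z * e - e * z * e) * e * x * f = 0"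
        using ef(1)[of x] by (simp add: peirce)
    qed
    then show ?thesis by (simp add: peirce)
  qed
  have f_left: "z * f = f * z * f"
  proof -
    have "(z * f - f * z * f) * f = 0"
    proof (rule ann_f)
      fix x show "(z * f - f * z * f) * f * x * e = 0"
        using ef(2)[of x] by (simp add: peirce)
    qed
    then show ?thesis by (simp add: peirce)
  qed
  have "e * z * f = 0" using f_left by (metis idems(3) mult.assoc)
  moreover have "e * z = e * z * e + e * z * f" using split_right by blast
  ultimately have ze: "z * e = e * z" using e_left by simp
  then have zf: "z * f = f * z" by (simp add: f_eq algebra_simps)
  have ee': "z * (e * y * e) = e * y * e * z" for y
  proof -
    have "(z * (e * y * e) - e * y * e * z) * e = 0"
    proof (rule ann_e)
      fix x
      have "z * (e * y * e * x * f) = e * y * e * x * f * z"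
        using ef(1)[of "y * e * x"] by (simp add: mult.assoc)
      moreover have "e * y * e * (z * (e * x * f)) = e * y * e * (e * x * f * z)"
        using ef(1)[of x] by simp
      ultimately show "(z * (e * y * e) - e * y * e * z) * e * x * f = 0"
        by (simp add: peirce)
    qed
    then show ?thesis by (simp add: peirce ze)
  qed
  have ff': "z * (f * y * f) = f * y * f * z" for y
  proof -
    have "(z * (f * y * f) - f * y * f * z) * f = 0"
    proof (rule ann_f)
      fix x
      have "z * (f * y * f * x * e) = f * y * f * x * e * z"
        using ef(2)[of "y * f * x"] by (simp add: mult.assoc)
      moreover have "f * y * f * (z * (f * x * e)) = f * y * f * (f * x * e * z)"
        using ef(2)[of x] by simp
      ultimately show "(z * (f * y * f) - f * y * f * z) * f * x * e = 0"
        by (simp add: peirce)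
    qed
    then show ?thesis by (simp add: peirce zf)
  qed
  have "z * (e * x * e + e * x * f + f * x * e + f * x * f)
    = (e * x * e + e * x * f + f * x * e + f * x * f) * z"
    using ee' ff' ef by (simp add: distrib_left distrib_right)
  then show ?thesis using decomp[of x] by simp
qed

text \<open>
  With \<open>z = G 1\<close> the hypothesis gives \<open>2 G a = a \<odot> z\<close>, hence \<open>(a \<odot> z) \<odot> b = a \<odot> (b \<odot> z)\<close>.  The
  failure of associativity of the Jordan product is \<open>(a \<odot> z) \<odot> b - a \<odot> (z \<odot> b) = [z, [a, b]]\<close>, so
  \<open>z\<close> commutes with all commutators.
\<close>

lemma jordan_self_adjoint:
  assumes G: "\<And>a b :: 'a. G a \<odot> b = a \<odot> G b"
  shows "G 1 * x = x * G 1" "G x = G 1 * x"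
proof -
  have G2: "G a + G a = a \<odot> G 1" for a
    using G[of a 1] by simp
  have "G 1 * (a * b - b * a) = (a * b - b * a) * G 1" for a b
  proof -
    have "(G a + G a) \<odot> b = a \<odot> (G b + G b)"
      using G[of a b] by (simp add: jordan_prod_distribs)
    then show ?thesis by (simp add: G2 jordan_prod_def algebra_simps)
  qed
  then show c: "G 1 * x = x * G 1" for x by (rule central_of_commutes_commutators)
  show "G x = G 1 * x" by (rule cancel2) (simp add: G2 jordan_prod_def c)
qed

end

section \<open>Additivity\<close>

text \<open>
  The map \<open>\<phi>\<close> is a Jordan derivation up to a factor \<open>2\<close> and a biadditive error \<open>E\<close>.  Any such \<open>E\<close>
  cancels from the identities for the deviation of \<open>\<phi>\<close> from additivity.
\<close>

locale jordan_map = peirce_ring e f for e f :: "'a :: {ring, monoid_mult}" +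
  fixes \<phi> :: "'a \<Rightarrow> 'a" and E :: "'a \<Rightarrow> 'a \<Rightarrow> 'a"
  assumes zero: "\<phi> 0 = 0"
    and E_add: "E (x + x') y = E x y + E x' y" "E x (y + y') = E x y + E x y'"
    and two_jordan: "\<phi> (x \<odot> y) + \<phi> (x \<odot> y) =
      (\<phi> x \<odot> y + \<phi> x \<odot> y) + (x \<odot> \<phi> y + x \<odot> \<phi> y) + E x y"
begin

definition defect :: "'a \<Rightarrow> 'a \<Rightarrow> 'a"
  where "defect x y = \<phi> (x + y) - \<phi> x - \<phi> y"

lemma swap_map: "jordan_map f e \<phi> E"
proof -
  interpret swapped: peirce_ring f e by (rule swap)
  show ?thesis by unfold_locales (fact zero E_add two_jordan)+
qed

lemma defect_zero [simp]: "defect 0 x = 0" "defect x 0 = 0"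
  by (simp_all add: defect_def zero)

lemma defect_eq_zero_iff: "defect x y = 0 \<longleftrightarrow> \<phi> (x + y) = \<phi> x + \<phi> y"
  by (auto simp: defect_def algebra_simps)

lemma defect_jordan: "defect x y \<odot> b = defect (x \<odot> b) (y \<odot> b)"
proof (rule cancel2)
  have "(x + y) \<odot> b = x \<odot> b + y \<odot> b" by (rule jordan_prod_distribs)
  then show "defect x y \<odot> b + defect x y \<odot> b
    = defect (x \<odot> b) (y \<odot> b) + defect (x \<odot> b) (y \<odot> b)"
    using two_jordan[of "x + y" b] two_jordan[of x b] two_jordan[of y b]
    by (simp add: defect_def jordan_prod_distribs E_add algebra_simps)
qed

text \<open>
  Multiplying by \<open>f\<close> annihilates the diagonal summand and so the defect, which therefore lies in \<open>eRe\<close>;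
  there it is detected by \<open>eRf\<close>, and \<open>\<odot> (e y f)\<close> annihilates the other summand.  For a summand in
  \<open>fRe\<close> that last product is merely diagonal, and vanishes after projection.
\<close>

lemma additive_diagonal_upper: "\<phi> (e * a * e + e * b * f) = \<phi> (e * a * e) + \<phi> (e * b * f)"
proof -
  have "defect (e * a * e) (e * b * f) = 0"
  proof (rule corner_zero)
    have "e * a * e \<odot> f = 0" by (simp add: jordan_prod_def peirce)
    then show "defect (e * a * e) (e * b * f) \<odot> f = 0" by (simp add: defect_jordan)
  next
    fix y
    have "e * b * f \<odot> (e * y * f) = 0" by (simp add: jordan_prod_def peirce)
    then show "defect (e * a * e) (e * b * f) \<odot> (e * y * f) \<odot> e \<odot> f = 0"
      by (simp add: defect_jordan)
  qed
  then show ?thesis by (simp add: defect_eq_zero_iff)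
qed

lemma additive_diagonal_lower: "\<phi> (e * a * e + f * b * e) = \<phi> (e * a * e) + \<phi> (f * b * e)"
proof -
  have "defect (e * a * e) (f * b * e) = 0"
  proof (rule corner_zero)
    have "e * a * e \<odot> f = 0" by (simp add: jordan_prod_def peirce)
    then show "defect (e * a * e) (f * b * e) \<odot> f = 0" by (simp add: defect_jordan)
  next
    fix y
    have "f * b * e \<odot> (e * y * f) \<odot> e \<odot> f = 0" by (simp add: jordan_prod_def peirce)
    then show "defect (e * a * e) (f * b * e) \<odot> (e * y * f) \<odot> e \<odot> f = 0"
      by (simp add: defect_jordan)
  qed
  then show ?thesis by (simp add: defect_eq_zero_iff)
qed

text \<open>
  The sum of two elements of \<open>eRf\<close> is a Jordan product: \<open>(e + x) \<odot> (f + y) = x + y\<close>.  Additivity is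
  already known on each factor, and expanding the product leaves \<open>\<phi> x + \<phi> y\<close>.
\<close>

lemma additive_upper: "\<phi> (e * a * f + e * b * f) = \<phi> (e * a * f) + \<phi> (e * b * f)"
proof (rule cancel2)
  interpret swapped: jordan_map f e \<phi> E by (rule swap_map)
  let ?x = "e * a * f" and ?y = "e * b * f"
  have "(e + ?x) \<odot> (f + ?y) = ?x + ?y" "e \<odot> f = 0" "?x \<odot> f = ?x" "e \<odot> ?y = ?y" "?x \<odot> ?y = 0"
    by (simp_all add: jordan_prod_def peirce add_ac)
  moreover have "\<phi> (e + ?x) = \<phi> e + \<phi> ?x" "\<phi> (f + ?y) = \<phi> f + \<phi> ?y"
    using additive_diagonal_upper[of 1 a] swapped.additive_diagonal_lower[of 1 b]
    by (simp_all add: ee ff)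
  ultimately show "\<phi> (?x + ?y) + \<phi> (?x + ?y) = (\<phi> ?x + \<phi> ?y) + (\<phi> ?x + \<phi> ?y)"
    using two_jordan[of "e + ?x" "f + ?y"] two_jordan[of e f] two_jordan[of e ?y]
      two_jordan[of ?x f] two_jordan[of ?x ?y]
    by (simp add: zero E_add jordan_prod_distribs algebra_simps)
qed

text \<open>
  Both summands are fixed by \<open>\<odot> e\<close>, hence so is the defect, which makes it off-diagonal.  Multiplying
  by \<open>e y f\<close> annihilates the first summand and detects the \<open>fRe\<close> part of the defect; \<open>f y e\<close>
  annihilates the second and detects the \<open>eRf\<close> part.
\<close>

lemma additive_upper_lower: "\<phi> (e * a * f + f * b * e) = \<phi> (e * a * f) + \<phi> (f * b * e)"
proof -
  let ?s = "defect (e * a * f) (f * b * e)"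
  have "e * a * f \<odot> e = e * a * f" "f * b * e \<odot> e = f * b * e"
    by (simp_all add: jordan_prod_def peirce)
  then have *: "?s * e + e * ?s = ?s"
    using defect_jordan[of "e * a * f" "f * b * e" e] by (simp add: jordan_prod_def)
  have "f * (?s * e + e * ?s) * f = f * ?s * f" "e * (?s * e + e * ?s) * e = e * ?s * e"
    unfolding * by simp_all
  then have diag: "f * ?s * f = 0" "e * ?s * e = 0" by (simp_all add: peirce)
  have "f * ?s * e * y * f = 0" for y
  proof -
    have "e * a * f \<odot> (e * y * f) = 0" by (simp add: jordan_prod_def peirce)
    then have "?s \<odot> (e * y * f) = 0" by (simp add: defect_jordan)
    then have "f * (?s \<odot> (e * y * f)) = 0" by simp
    then show ?thesis by (simp add: jordan_prod_def peirce)
  qed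
  then have l: "f * ?s * e = 0" by (rule ann_e)
  have "e * ?s * f * y * e = 0" for y
  proof -
    have "f * b * e \<odot> (f * y * e) = 0" by (simp add: jordan_prod_def peirce)
    then have "?s \<odot> (f * y * e) = 0" by (simp add: defect_jordan)
    then have "e * (?s \<odot> (f * y * e)) = 0" by simp
    then show ?thesis by (simp add: jordan_prod_def peirce)
  qed
  then have "e * ?s * f = 0" by (rule ann_f)
  with diag l have "?s = 0" using decomp[of ?s] by simp
  then show ?thesis by (simp add: defect_eq_zero_iff)
qed

lemma defect_off_diagonal: "defect x y \<odot> e \<odot> f = 0"
proof -
  interpret swapped: jordan_map f e \<phi> E by (rule swap_map)
  have "e * x * f + f * x * e + (e * y * f + f * y * e) = e * (x + y) * f + f * (x + y) * e"
    by (simp add: algebra_simps)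
  then have "\<phi> (e * x * f + f * x * e + (e * y * f + f * y * e))
    = \<phi> (e * (x + y) * f) + \<phi> (f * (x + y) * e)"
    by (simp only: additive_upper_lower)
  also have "\<dots> = \<phi> (e * x * f + f * x * e) + \<phi> (e * y * f + f * y * e)"
    using additive_upper[of x y] swapped.additive_upper[of x y]
    by (simp add: additive_upper_lower distrib_left distrib_right)
  finally show ?thesis by (simp add: defect_jordan off_diagonal defect_eq_zero_iff)
qed

text \<open>
  All defects have zero off-diagonal part, and the Jordan multiples of a defect are again defects.
  In particular \<open>defect x y \<odot> e\<close> lies in \<open>eRe\<close> and annihilates \<open>eRf\<close>.
\<close>

lemma defect_jordan_e: "defect x y \<odot> e = 0"
proof (rule corner_zero)
  show "defect x y \<odot> e \<odot> f = 0" by (rule defect_off_diagonal)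
  show "defect x y \<odot> e \<odot> (e * z * f) \<odot> e \<odot> f = 0" for z
    unfolding defect_jordan[of x y] defect_jordan[of "x \<odot> e"] by (rule defect_off_diagonal)
qed

theorem map_add: "\<phi> (x + y) = \<phi> x + \<phi> y"
proof -
  interpret swapped: jordan_map f e \<phi> E by (rule swap_map)
  have "defect x y \<odot> e = 0" "defect x y \<odot> f = 0"
    by (rule defect_jordan_e swapped.defect_jordan_e)+
  then have "defect x y \<odot> (e + f) = 0" by (simp add: jordan_prod_distribs)
  then have "defect x y + defect x y = 0" by (simp add: e_plus_f)
  then have "defect x y = 0" by (rule tf)
  then show ?thesis by (simp add: defect_eq_zero_iff)
qed

end

section \<open>Jordan derivations are derivations\<close>

text \<open>
  For a Jordan derivation compatible with the Peirce decomposition the deviation from the Leibniz rule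
  is biadditive, antisymmetric and balanced over \<open>e\<close> and \<open>f\<close>.  Antisymmetry lets a pair of Peirce
  components be exchanged, and if the exchanged product has mismatched inner idempotents, the
  deviation vanishes.
\<close>

locale peirce_jordan_derivation = peirce_ring e f for e f :: "'a :: {ring, monoid_mult}" +
  fixes d :: "'a \<Rightarrow> 'a"
  assumes d_add: "d (x + y) = d x + d y"
    and d_jordan: "d (x \<odot> y) = d x \<odot> y + x \<odot> d y"
    and d_e: "d (e * x) = e * d x" "d (x * e) = d x * e"
begin

lemma additive_d: "additive d"
  by unfold_locales (rule d_add)

lemma d_zero: "d 0 = 0" and d_diff: "d (x - y) = d x - d y"
  using additive.zero additive.diff additive_d by blast+

lemma d_f: "d (f * x) = f * d x" "d (x * f) = d x * f"
  by (simp_all add: f_eq left_diff_distrib right_diff_distrib d_diff d_e)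

lemma swap_derivation: "peirce_jordan_derivation f e d"
proof -
  interpret swapped: peirce_ring f e by (rule swap)
  show ?thesis by unfold_locales (fact d_add d_jordan d_f)+
qed

definition leibniz_defect :: "'a \<Rightarrow> 'a \<Rightarrow> 'a"
  where "leibniz_defect x y = d (x * y) - d x * y - x * d y"

lemma leibniz_defect_add_left:
  "leibniz_defect (x + x') y = leibniz_defect x y + leibniz_defect x' y"
  by (simp add: leibniz_defect_def d_add algebra_simps)

lemma leibniz_defect_zero: "leibniz_defect 0 y = 0" "leibniz_defect x 0 = 0"
  by (simp_all add: leibniz_defect_def d_zero)

lemma leibniz_defect_commute: "leibniz_defect x y = - leibniz_defect y x"
  using d_jordan[of x y] by (simp add: leibniz_defect_def jordan_prod_def d_add algebra_simps)

lemma leibniz_defect_idem: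
  "leibniz_defect (e * x) y = e * leibniz_defect x y"
  "leibniz_defect x (y * e) = leibniz_defect x y * e"
  "leibniz_defect x (y * f) = leibniz_defect x y * f"
  "leibniz_defect (x * e) y = leibniz_defect x (e * y)"
  "leibniz_defect (x * f) y = leibniz_defect x (f * y)"
  using d_e(2)[of "x * y"] d_f(2)[of "x * y"] d_e(1)[of "x * y"]
  by (simp_all add: leibniz_defect_def d_e d_f right_diff_distrib left_diff_distrib mult.assoc)

text \<open>
  The Hochschild cocycle identity: the deviation is the coboundary of \<open>d\<close> up to sign.  It carries the
  vanishing on pairs with an off-diagonal entry over to pairs of diagonal entries.
\<close>

lemma leibniz_defect_cocycle:
  "leibniz_defect (x * y) z + leibniz_defect x y * z
    = leibniz_defect x (y * z) + x * leibniz_defect y z"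
  by (simp add: leibniz_defect_def algebra_simps)

lemma leibniz_defect_mismatch:
  "leibniz_defect (x * e) (f * y) = 0" "leibniz_defect (x * f) (e * y) = 0"
  by (simp_all add: leibniz_defect_idem idems leibniz_defect_zero)

lemma leibniz_defect_split:
  "leibniz_defect x y = leibniz_defect (x * e) (e * y) + leibniz_defect (x * f) (f * y)"
proof -
  have "leibniz_defect x y = leibniz_defect (x * e + x * f) y"
    using split_right[of x] by simp
  then show ?thesis
    by (simp add: leibniz_defect_add_left leibniz_defect_idem idems)
qed

lemma leibniz_defect_upper: "leibniz_defect (e * x) (y * f) = 0"
proof -
  have "leibniz_defect (y * f) (e * x * e) = 0" "leibniz_defect (f * y * f) (e * x) = 0"
    using leibniz_defect_mismatch(2)[of y "x * e"] leibniz_defect_mismatch(2)[of "f * y" x]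
    by (simp_all add: mult.assoc)
  then have 0: "leibniz_defect (e * x * e) (y * f) = 0" "leibniz_defect (e * x) (f * y * f) = 0"
    using leibniz_defect_commute by (metis minus_zero)+
  have "leibniz_defect (e * x) (y * f)
    = leibniz_defect (e * x) (e * (y * f)) + leibniz_defect (e * x) (f * (y * f))"
    using leibniz_defect_split[of "e * x" "y * f"] by (simp only: leibniz_defect_idem(4,5) idems)
  also have "leibniz_defect (e * x) (e * (y * f)) = leibniz_defect (e * x * e) (y * f)"
    by (rule leibniz_defect_idem(4)[symmetric])
  finally show ?thesis using 0 by (simp add: mult.assoc)
qed

text \<open>
  Split through the inner idempotents.  On \<open>eRf \<times> fRe\<close> the deviation takes values in \<open>eRe\<close>, but by
  antisymmetry also in \<open>fRf\<close>.  On \<open>eRe \<times> eRe\<close> the cocycle identity with an element of \<open>eRf\<close> as third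
  argument shows that the value annihilates \<open>eRf\<close>.
\<close>

lemma leibniz_defect_diagonal: "e * leibniz_defect x y * e = 0"
proof -
  interpret swapped: peirce_jordan_derivation f e d by (rule swap_derivation)
  have corner: "leibniz_defect (e * u) (v * e) = e * leibniz_defect u v * e" for u v
    by (simp add: leibniz_defect_idem(1,2) mult.assoc)
  have corner': "leibniz_defect (f * u) (v * f) = f * leibniz_defect u v * f" for u v
    by (simp add: swapped.leibniz_defect_idem(1,2) mult.assoc)
  have "leibniz_defect (e * (x * f)) (f * y * e) = - leibniz_defect (f * (y * e)) (e * x * f)"
    using leibniz_defect_commute by (metis mult.assoc)
  then have "e * leibniz_defect (x * f) (f * y) * e
      = - (f * leibniz_defect (y * e) (e * x) * f)"
    using corner[of "x * f" "f * y"] corner'[of "y * e" "e * x"] by simp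
  then have "e * (e * leibniz_defect (x * f) (f * y) * e)
      = e * - (f * leibniz_defect (y * e) (e * x) * f)" by simp
  then have 1: "e * leibniz_defect (x * f) (f * y) * e = 0" by (simp add: peirce)
  have "leibniz_defect (e * x * e) (e * y * e) * e * z * f = 0" for z
    using leibniz_defect_cocycle[of "e * x * e" "e * y * e" "e * z * f"]
      leibniz_defect_upper[of "x * e * (e * y * e)" "e * z"]
      leibniz_defect_upper[of "x * e" "e * y * e * (e * z)"]
      leibniz_defect_upper[of "y * e" "e * z"]
    by (simp add: mult.assoc)
  then have "leibniz_defect (e * x * e) (e * y * e) * e = 0" by (rule ann_e)
  moreover have "leibniz_defect (e * x * e) (e * y * e) = e * leibniz_defect (x * e) (e * y) * e"
    using corner[of "x * e" "e * y"] by (simp only: mult.assoc)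
  ultimately have 2: "e * leibniz_defect (x * e) (e * y) * e = 0" by (simp add: peirce)
  have "e * leibniz_defect x y * e
    = e * leibniz_defect (x * e) (e * y) * e + e * leibniz_defect (x * f) (f * y) * e"
    by (subst leibniz_defect_split) (simp only: distrib_left distrib_right)
  with 1 2 show ?thesis by simp
qed

theorem leibniz: "d (x * y) = d x * y + x * d y"
proof -
  interpret swapped: peirce_jordan_derivation f e d by (rule swap_derivation)
  have "e * leibniz_defect x y * f = 0" "f * leibniz_defect x y * e = 0"
    using leibniz_defect_upper[of x y] swapped.leibniz_defect_upper[of x y]
    by (simp_all add: leibniz_defect_idem swapped.leibniz_defect_idem mult.assoc)
  then have "leibniz_defect x y = 0"
    using decomp[of "leibniz_defect x y"] leibniz_defect_diagonal
      swapped.leibniz_defect_diagonal by simp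
  then show ?thesis by (simp add: leibniz_defect_def algebra_simps)
qed

end

text \<open>
  The factorization of \<open>e\<close> through \<open>f\<close> excludes Jordan derivations that exchange \<open>eRf\<close> and \<open>fRe\<close>.
  Vanishing at \<open>e\<close>, hence at \<open>f\<close>, makes \<open>d\<close> commute with the maps \<open>x \<mapsto> x \<odot> e\<close> and \<open>x \<mapsto> x \<odot> f\<close>, whose
  combinations are the projections onto \<open>eRe\<close>, \<open>fRf\<close> and \<open>eRf + fRe\<close>.
\<close>

locale jordan_derivation_fixing_e = peirce_ring e f for e f :: "'a :: {ring, monoid_mult}" +
  fixes p q :: 'a and d :: "'a \<Rightarrow> 'a"
  assumes factor: "e * p * f * q * e = e"
    and d_add: "d (x + y) = d x + d y"
    and d_jordan: "d (x \<odot> y) = d x \<odot> y + x \<odot> d y"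
    and d_e: "d e = 0"
begin

lemma additive_d: "additive d"
  by unfold_locales (rule d_add)

lemma d_zero: "d 0 = 0" and d_diff: "d (x - y) = d x - d y"
  using additive.zero additive.diff additive_d by blast+

lemma d_f: "d f = 0"
proof -
  have "d 1 + d 1 = (d 1 + d 1) + (d 1 + d 1)"
    using d_jordan[of 1 1] by (simp add: d_add)
  then have "d 1 + d 1 = 0" by simp
  then have "d 1 = 0" by (rule tf)
  then show ?thesis using d_add[of e f] by (simp add: e_plus_f d_e)
qed

lemma d_jordan_idem: "d (x \<odot> e) = d x \<odot> e" "d (x \<odot> f) = d x \<odot> f"
  by (simp_all add: d_jordan d_e d_f)

lemma d_corner: "d (e * x * e) = e * d x * e" "d (f * x * f) = f * d x * f"
proof -
  have E: "y \<odot> e \<odot> e - y \<odot> e = e * y * e + e * y * e" for y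
    by (simp add: jordan_prod_def peirce)
  have "d (x \<odot> e \<odot> e - x \<odot> e) = d x \<odot> e \<odot> e - d x \<odot> e"
    by (simp add: d_diff d_jordan_idem)
  then have "d (e * x * e) + d (e * x * e) = e * d x * e + e * d x * e"
    unfolding E by (simp only: d_add)
  then show "d (e * x * e) = e * d x * e" by (rule cancel2)
  have F: "y \<odot> f \<odot> f - y \<odot> f = f * y * f + f * y * f" for y
    by (simp add: jordan_prod_def peirce)
  have "d (x \<odot> f \<odot> f - x \<odot> f) = d x \<odot> f \<odot> f - d x \<odot> f"
    by (simp add: d_diff d_jordan_idem)
  then have "d (f * x * f) + d (f * x * f) = f * d x * f + f * d x * f"
    unfolding F by (simp only: d_add)
  then show "d (f * x * f) = f * d x * f" by (rule cancel2)
qed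

lemma d_off_diagonal: "d (e * x * f + f * x * e) = e * d x * f + f * d x * e"
  by (simp add: d_jordan_idem flip: off_diagonal)

text \<open>
  Let \<open>\<sigma> x\<close> be the \<open>fRe\<close> part of \<open>d x\<close> for \<open>x\<close> in \<open>eRf\<close>.  As \<open>x \<odot> y = 0\<close> on \<open>eRf\<close>, one has
  \<open>\<sigma> x y = - \<sigma> y x\<close>, so with \<open>p\<close>, \<open>q\<close> replaced by their off-diagonal parts
  \<open>\<sigma> x = \<sigma> x p q = - \<sigma> p x q\<close>.  For \<open>x = p\<close> this reads \<open>\<sigma> p = - \<sigma> p\<close>, whence \<open>\<sigma> p = 0\<close> and then
  \<open>\<sigma> = 0\<close>.
\<close>

lemma d_upper_lower_zero: "f * d (e * x * f) * e = 0"
proof -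
  have *: "f * d (e * x * f) * e * y * f = - (f * d (e * y * f) * e * x * f)" for x y
  proof -
    have "e * x * f \<odot> (e * y * f) = 0" by (simp add: jordan_prod_def peirce)
    then have "d (e * x * f) \<odot> (e * y * f) + e * x * f \<odot> d (e * y * f) = 0"
      by (metis d_jordan d_zero)
    then have "f * (d (e * x * f) \<odot> (e * y * f) + e * x * f \<odot> d (e * y * f)) * f = 0" by simp
    then show ?thesis by (simp add: jordan_prod_def peirce eq_neg_iff_add_eq_0)
  qed
  have **: "f * d (e * x * f) * e = - (f * d (e * p * f) * e * x * f * q * e)" for x
  proof -
    have "f * d (e * x * f) * e = f * d (e * x * f) * (e * p * f * q * e)"
      by (simp add: factor)
    also have "\<dots> = f * d (e * x * f) * e * p * f * q * e" by (simp add: mult.assoc)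
    finally show ?thesis by (simp add: *[of x p])
  qed
  have "f * d (e * p * f) * e * p * f * q * e = f * d (e * p * f) * e"
    using factor by (simp add: mult.assoc)
  then have "f * d (e * p * f) * e + f * d (e * p * f) * e = 0"
    using **[of p] by (simp only: flip: eq_neg_iff_add_eq_0)
  then have "f * d (e * p * f) * e = 0" by (rule tf)
  then show ?thesis using **[of x] by simp
qed

text \<open>
  The same argument on \<open>fRe\<close>, with \<open>q\<close> in the role of \<open>p\<close> and the factorization of \<open>e\<close> multiplied
  from the left.
\<close>

lemma d_lower_upper_zero: "e * d (f * x * e) * f = 0"
proof -
  have *: "f * y * e * d (f * x * e) * f = - (f * x * e * d (f * y * e) * f)" for x y
  proof -
    have "f * x * e \<odot> (f * y * e) = 0" by (simp add: jordan_prod_def peirce)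
    then have "d (f * x * e) \<odot> (f * y * e) + f * x * e \<odot> d (f * y * e) = 0"
      by (metis d_jordan d_zero)
    then have "f * (d (f * x * e) \<odot> (f * y * e) + f * x * e \<odot> d (f * y * e)) * f = 0" by simp
    then show ?thesis by (simp add: jordan_prod_def peirce eq_neg_iff_add_eq_0)
  qed
  have **: "e * d (f * x * e) * f = - (e * p * (f * x * e * d (f * q * e) * f))" for x
  proof -
    have "e * d (f * x * e) * f = e * p * f * q * e * d (f * x * e) * f"
      by (simp add: factor)
    also have "\<dots> = e * p * (f * q * e * d (f * x * e) * f)" by (simp add: mult.assoc)
    finally show ?thesis unfolding *[of q x] by simp
  qed
  have "e * p * (f * q * e * d (f * q * e) * f) = e * p * f * q * e * d (f * q * e) * f"
    by (simp add: mult.assoc)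
  then have "e * d (f * q * e) * f + e * d (f * q * e) * f = 0"
    using **[of q] by (simp only: factor flip: eq_neg_iff_add_eq_0)
  then have "e * d (f * q * e) * f = 0" by (rule tf)
  then have "f * x * e * d (f * q * e) * f = 0" by (metis mult.assoc mult_zero_right)
  then show ?thesis using **[of x] by simp
qed

lemma d_peirce: "d (e * x * f) = e * d x * f" "d (f * x * e) = f * d x * e"
proof -
  have "d (e * x * f) = e * d (e * x * f) * f + f * d (e * x * f) * e"
    using d_off_diagonal[of "e * x * f"] by (simp add: peirce)
  then have u: "d (e * x * f) = e * d (e * x * f) * f" by (simp add: d_upper_lower_zero)
  have "d (f * x * e) = e * d (f * x * e) * f + f * d (f * x * e) * e"
    using d_off_diagonal[of "f * x * e"] by (simp add: peirce)
  then have l: "d (f * x * e) = f * d (f * x * e) * e" by (simp add: d_lower_upper_zero)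
  have s: "d (e * x * f) + d (f * x * e) = e * d x * f + f * d x * e"
    using d_off_diagonal[of x] by (simp add: d_add)
  then have "e * (d (e * x * f) + d (f * x * e)) * f = e * (e * d x * f + f * d x * e) * f"
    by simp
  then show "d (e * x * f) = e * d x * f"
    by (subst u) (subst (asm) l, simp add: peirce)
  with s show "d (f * x * e) = f * d x * e" by simp
qed

lemma d_idem: "d (e * x) = e * d x" "d (x * e) = d x * e" "d (f * x) = f * d x" "d (x * f) = d x * f"
proof -
  show "d (e * x) = e * d x"
    using d_add[of "e * x * e" "e * x * f"] split_right[of "e * x"] split_right[of "e * d x"]
    by (metis d_peirce d_corner)
  show "d (f * x) = f * d x"
    using d_add[of "f * x * e" "f * x * f"] split_right[of "f * x"] split_right[of "f * d x"]
    by (metis d_peirce d_corner)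
  show "d (x * e) = d x * e"
    using d_add[of "e * x * e" "f * x * e"] split_left[of "x * e"] split_left[of "d x * e"]
    by (metis d_peirce d_corner mult.assoc)
  show "d (x * f) = d x * f"
    using d_add[of "e * x * f" "f * x * f"] split_left[of "x * f"] split_left[of "d x * f"]
    by (metis d_peirce d_corner mult.assoc)
qed

end

text \<open>
  Subtracting an inner derivation makes \<open>d\<close> vanish at \<open>e\<close>: the image \<open>d e\<close> is off-diagonal because
  \<open>2 d e = 2 (e \<odot> d e)\<close>, and \<open>[[c, e], e] = c\<close> for off-diagonal \<open>c\<close>.
\<close>

theorem (in peirce_ring) jordan_derivation_is_derivation:
  fixes d :: "'a \<Rightarrow> 'a"
  assumes factor: "e * p * f * q * e = e"
    and d: "additive d" and d_jordan: "\<And>x y. d (x \<odot> y) = d x \<odot> y + x \<odot> d y"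
  shows "derivation d"
proof -
  \<comment> \<open>The commutator \<open>[d e, e]\<close>.\<close>
  define m where "m = d e * e - e * d e"
  define d' where "d' x = d x - (m * x - x * m)" for x
  have add: "d (x + y) = d x + d y" for x y using d by (rule additive.add)
  have "d e + d e = (d e * e + e * d e) + (d e * e + e * d e)"
    using d_jordan[of e e] by (simp add: jordan_prod_def ee add)
  then have c: "d e = d e * e + e * d e" by (rule cancel2)
  then have "e * d e * e = e * (d e * e + e * d e) * e" by simp
  then have "e * d e * e = 0" by (simp add: peirce)
  then have d'_e: "d' e = 0" using c by (simp add: d'_def m_def peirce)
  have d'_add: "d' (x + y) = d' x + d' y" for x y
    by (simp add: d'_def add algebra_simps)
  have d'_jordan: "d' (x \<odot> y) = d' x \<odot> y + x \<odot> d' y" for x y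
    by (simp only: d'_def d_jordan) (simp add: jordan_prod_def algebra_simps)
  interpret fixing_e: jordan_derivation_fixing_e e f p q d'
    by unfold_locales (fact factor d'_add d'_jordan d'_e)+
  interpret peirce_jordan_derivation e f d'
    by unfold_locales (fact fixing_e.d_add fixing_e.d_jordan fixing_e.d_idem)+
  have "d (x * y) = d x * y + x * d y" for x y
    using leibniz[of x y] by (simp add: d'_def algebra_simps)
  then show ?thesis using d by (simp add: derivation_def)
qed

section \<open>Generalized Jordan derivations\<close>

text \<open>
  The constant \<open>w = \<delta> 1\<close> accompanies every computation with tuples that end in ones.  Additivity of
  \<open>\<delta>\<close> comes first: only then can the powers of \<open>2\<close> be pulled out of the arguments of \<open>\<delta>\<close>, which
  leaves \<open>(n - 1) (a \<odot> w) = 0\<close> and makes \<open>w\<close> central.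
\<close>

lemma (in peirce_ring) mult_jordan_derivation_structure:
  fixes \<delta> :: "'a \<Rightarrow> 'a"
  assumes factor: "e * p * f * q * e = e"
    and \<delta>: "mult_jordan_derivation n \<delta>" and n: "n \<ge> 2"
  shows "(\<forall>x. \<delta> 1 * x = x * \<delta> 1) \<and> derivation (\<lambda>x. \<delta> x - \<delta> 1 * x)"
proof -
  define w where "w = \<delta> 1"
  define m where "m = n - 2"
  have two_m: "nsmul 2 (nsmul (n - 2) (nsmul (2 ^ (n - 3)) x)) = nsmul (2 ^ m) (nsmul m x)" for x :: 'a
  proof (cases m)
    case 0
    then show ?thesis by (simp add: m_def)
  next
    case (Suc k)
    then have "n - 2 = Suc k" "n - 3 = k" by (simp_all add: m_def)
    then show ?thesis by (simp add: Suc nsmul_nsmul mult_ac del: nsmul.simps)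
  qed
  have two_pow: "nsmul 2 (nsmul (2 ^ m) x) = nsmul (2 ^ m) (x + x)" for x :: 'a
    by (simp only: nsmul_two nsmul_add)
  have pair: "nsmul 2 (\<delta> (nsmul (2 ^ m) (a \<odot> b)))
    = nsmul (2 ^ m) (nsmul 2 (\<delta> a \<odot> b + a \<odot> \<delta> b) + nsmul m ((a \<odot> b) \<odot> w))" for a b
  proof -
    have "nsmul 2 (\<delta> (nsmul (2 ^ m) (a \<odot> b))) = nsmul 2 (nsmul (2 ^ m) (\<delta> a \<odot> b + a \<odot> \<delta> b))
      + nsmul 2 (nsmul (n - 2) (nsmul (2 ^ (n - 3)) ((a \<odot> b) \<odot> w)))"
      using mult_jordan_derivation_pair[OF \<delta> n, of a b] by (simp only: m_def w_def nsmul_add)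
    also have "\<dots> = nsmul (2 ^ m) (nsmul 2 (\<delta> a \<odot> b + a \<odot> \<delta> b))
      + nsmul (2 ^ m) (nsmul m ((a \<odot> b) \<odot> w))"
      by (simp only: two_m two_pow) (simp only: nsmul_two)
    finally show ?thesis by (simp only: nsmul_add)
  qed
  have ends: "nsmul m ((a \<odot> b) \<odot> w) = nsmul m ((a \<odot> w) \<odot> b)" for a b
  proof -
    have "nsmul (n - 2) (nsmul (2 ^ (n - 3)) ((a \<odot> b) \<odot> w))
      = nsmul (n - 2) (nsmul (2 ^ (n - 3)) ((a \<odot> w) \<odot> b))"
      using mult_jordan_derivation_pair[OF \<delta> n, of a b] mult_jordan_derivation_ends[OF \<delta> n, of a b]
      by (simp add: w_def)
    then have "nsmul (2 ^ m) (nsmul m ((a \<odot> b) \<odot> w)) = nsmul (2 ^ m) (nsmul m ((a \<odot> w) \<odot> b))"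
      by (metis two_m)
    then show ?thesis by (rule pow2_cancel)
  qed
  have double: "\<delta> (nsmul (2 ^ m) (a + a)) = nsmul (2 ^ m) (\<delta> a + \<delta> a + nsmul (Suc m) (a \<odot> w))" for a
  proof (rule cancel2)
    show "\<delta> (nsmul (2 ^ m) (a + a)) + \<delta> (nsmul (2 ^ m) (a + a))
      = nsmul (2 ^ m) (\<delta> a + \<delta> a + nsmul (Suc m) (a \<odot> w))
        + nsmul (2 ^ m) (\<delta> a + \<delta> a + nsmul (Suc m) (a \<odot> w))"
      using pair[of a 1]
      by (simp add: nsmul_two w_def[symmetric] jordan_prod_distribs algebra_simps flip: nsmul_add)
  qed
  \<comment> \<open>The identity for \<open>\<delta> (a \<odot> b)\<close> is obtained by computing \<open>\<delta> (2\<^sup>m\<^sup>+\<^sup>1 (a \<odot> b))\<close> in two ways; it contains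
    \<open>\<delta> (2 a)\<close>, whose deviation from \<open>2 \<delta> a\<close> has to be shown additive.\<close>
  define D where "D a = \<delta> (a + a) - (\<delta> a + \<delta> a)" for a
  have D: "\<delta> (a \<odot> b) + \<delta> (a \<odot> b)
    = (\<delta> a \<odot> b + \<delta> a \<odot> b) + (a \<odot> \<delta> b + a \<odot> \<delta> b) + (D a \<odot> b - (a \<odot> b) \<odot> w)" for a b
  proof -
    have "\<delta> (nsmul (2 ^ m) ((a + a) \<odot> b))
      = nsmul (2 ^ m) (\<delta> (a + a) \<odot> b + (a + a) \<odot> \<delta> b + nsmul m ((a \<odot> b) \<odot> w))"
      by (rule cancel2, insert pair[of "a + a" b])
        (simp add: nsmul_two jordan_prod_distribs algebra_simps flip: nsmul_add)
    moreover have "(a + a) \<odot> b = a \<odot> b + a \<odot> b" by (rule jordan_prod_distribs)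
    ultimately have "nsmul (2 ^ m) (\<delta> (a \<odot> b) + \<delta> (a \<odot> b) + nsmul (Suc m) ((a \<odot> b) \<odot> w))
      = nsmul (2 ^ m) (\<delta> (a + a) \<odot> b + (a + a) \<odot> \<delta> b + nsmul m ((a \<odot> b) \<odot> w))"
      using double[of "a \<odot> b"] by simp
    from pow2_cancel[OF this]
    have "\<delta> (a \<odot> b) + \<delta> (a \<odot> b) + (a \<odot> b) \<odot> w = \<delta> (a + a) \<odot> b + (a \<odot> \<delta> b + a \<odot> \<delta> b)"
      by (simp add: algebra_simps jordan_prod_distribs)
    then show ?thesis by (simp add: D_def algebra_simps jordan_prod_distribs)
  qed
  \<comment> \<open>All other terms of this identity are symmetric in \<open>a\<close> and \<open>b\<close>.\<close>
  have "D a \<odot> b = a \<odot> D b" for a b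
    using D[of a b] D[of b a] by (simp add: jordan_prod_commute algebra_simps)
  then have D1: "D x = D 1 * x" for x by (rule jordan_self_adjoint)
  interpret jordan_map e f \<delta> "\<lambda>a b. D 1 * a \<odot> b - (a \<odot> b) \<odot> w"
  proof
    show "\<delta> 0 = 0" using \<delta> n by (rule mult_jordan_derivation_zero)
    show "\<delta> (x \<odot> y) + \<delta> (x \<odot> y) = (\<delta> x \<odot> y + \<delta> x \<odot> y) + (x \<odot> \<delta> y + x \<odot> \<delta> y)
      + (D 1 * x \<odot> y - (x \<odot> y) \<odot> w)" for x y
      unfolding D1[of x, symmetric] by (rule D)
  qed (simp_all add: jordan_prod_distribs distrib_left)
  have D0: "D a = 0" for a by (simp add: D_def map_add)
  have nsm: "\<delta> (nsmul k a) = nsmul k (\<delta> a)" for k a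
    by (induction k) (simp_all add: map_add zero)
  have vanish: "nsmul (Suc m) (a \<odot> w) = 0" for a
  proof -
    have "nsmul (2 ^ m) (\<delta> a + \<delta> a) = nsmul (2 ^ m) (\<delta> a + \<delta> a + nsmul (Suc m) (a \<odot> w))"
      using double[of a] by (simp only: nsm map_add)
    from pow2_cancel[OF this] show ?thesis by simp
  qed
  \<comment> \<open>The two multiples \<open>m + 1\<close> and \<open>m\<close> of the difference of both sides vanish, hence so does the
    difference.\<close>
  have assoc: "(a \<odot> b) \<odot> w = (a \<odot> w) \<odot> b" for a b
  proof -
    have 1: "(a \<odot> b) \<odot> w + nsmul m ((a \<odot> b) \<odot> w) = 0"
      using vanish[of "a \<odot> b"] by simp
    have "nsmul (Suc m) (a \<odot> w) \<odot> b = 0" by (simp only: vanish jordan_prod_zero)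
    then have 2: "(a \<odot> w) \<odot> b + nsmul m ((a \<odot> w) \<odot> b) = 0"
      by (simp only: nsmul_jordan_left nsmul.simps jordan_prod_distribs)
    from 1 2 show ?thesis using ends[of a b] by (simp add: eq_neg_iff_add_eq_0[symmetric])
  qed
  have central: "w * x = x * w" for x
  proof (rule central_of_commutes_commutators)
    fix a b
    have *: "a * b * w + w * b * a = a * w * b + b * w * a" for a b
      using assoc[of a b] by (simp add: jordan_prod_def algebra_simps)
    have "a * b * w + w * b * a = b * a * w + w * a * b"
      unfolding *[of a b] *[of b a] by (rule add.commute)
    then show "w * (a * b - b * a) = (a * b - b * a) * w"
      by (simp add: algebra_simps)
  qed
  have "derivation (\<lambda>x. \<delta> x - w * x)"
  proof (rule jordan_derivation_is_derivation[OF factor])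
    show "additive (\<lambda>x. \<delta> x - w * x)" by unfold_locales (simp add: map_add algebra_simps)
    fix x y
    have wl: "w * a \<odot> b = w * (a \<odot> b)" "a \<odot> (w * b) = w * (a \<odot> b)" "a \<odot> w = w * a + w * a" for a b
    proof -
      have left: "u * (w * v) = w * (u * v)" for u v
        by (metis central mult.assoc)
      show "w * a \<odot> b = w * (a \<odot> b)" "a \<odot> (w * b) = w * (a \<odot> b)"
        by (simp_all only: jordan_prod_def left mult.assoc distrib_left)
      show "a \<odot> w = w * a + w * a" using central[of a] by (simp add: jordan_prod_def)
    qed
    show "\<delta> (x \<odot> y) - w * (x \<odot> y) = (\<delta> x - w * x) \<odot> y + x \<odot> (\<delta> y - w * y)"
      by (rule cancel2, insert D[of x y]) (simp add: D0 jordan_prod_distribs wl algebra_simps)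
  qed
  with central show ?thesis by (simp add: w_def)
qed

theorem (in peirce_ring) mult_gen_jordan_derivation_structure:
  fixes \<Delta> :: "'a \<Rightarrow> 'a"
  assumes factor: "e * p * f * q * e = e"
    and \<Delta>: "mult_gen_jordan_derivation n \<Delta>" and n: "n \<ge> 2"
  obtains z :: 'a and d where "\<And>x. z * x = x * z" "derivation d" "\<And>x. \<Delta> x = z * x + d x"
proof -
  obtain \<delta> where \<delta>: "mult_jordan_derivation n \<delta>"
    and rel: "\<And>t. \<Delta> (jordan_q n t) =
        jordan_q n (t(1 := \<Delta> (t 1))) + (\<Sum>i=2..n. jordan_q n (t(i := \<delta> (t i))))"
    using \<Delta> by (auto simp: mult_gen_jordan_derivation_def)
  define G where "G x = \<Delta> x - \<delta> x" for x
  have G: "G (nsmul (2 ^ (n - 2)) (a \<odot> b)) = nsmul (2 ^ (n - 2)) (G a \<odot> b)" for a b :: 'a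
  proof -
    define t where "t = (\<lambda>_ :: nat. 1 :: 'a)(1 := a, 2 := b)"
    have t1: "t(1 := c) = (\<lambda>_. 1)(1 := c, 2 := b)" for c by (auto simp: t_def)
    have a: "t 1 = a" by (simp add: t_def)
    have "{1..n} = insert 1 {2..n}" using n by auto
    then have "\<delta> (jordan_q n t) =
        jordan_q n (t(1 := \<delta> (t 1))) + (\<Sum>i=2..n. jordan_q n (t(i := \<delta> (t i))))"
      using \<delta> by (simp add: mult_jordan_derivation_def)
    then have "G (jordan_q n t) = jordan_q n (t(1 := \<Delta> a)) - jordan_q n (t(1 := \<delta> a))"
      using rel[of t] by (simp add: G_def a[simplified])
    then show ?thesis
      by (simp only: t1 jordan_q_pair[OF n]) (simp only: t_def jordan_q_pair[OF n] G_def
        jordan_prod_distribs nsmul_diff)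
  qed
  have "G a \<odot> b = a \<odot> G b" for a b
  proof (rule pow2_cancel)
    show "nsmul (2 ^ (n - 2)) (G a \<odot> b) = nsmul (2 ^ (n - 2)) (a \<odot> G b)"
      using G[of a b] G[of b a] by (metis jordan_prod_commute)
  qed
  from jordan_self_adjoint[OF this] have G1: "G 1 * x = x * G 1" "G x = G 1 * x" for x by blast+
  from mult_jordan_derivation_structure[OF factor \<delta> n]
  have w: "\<delta> 1 * x = x * \<delta> 1" and der: "derivation (\<lambda>x. \<delta> x - \<delta> 1 * x)" for x by auto
  show thesis
  proof (rule that)
    show "(G 1 + \<delta> 1) * x = x * (G 1 + \<delta> 1)" for x
      using G1(1)[of x] w[of x] by (simp add: distrib_left distrib_right)
    show "derivation (\<lambda>x. \<delta> x - \<delta> 1 * x)" by (rule der)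
    show "\<Delta> x = (G 1 + \<delta> 1) * x + (\<delta> x - \<delta> 1 * x)" for x
      using G1(2)[of x] by (simp add: G_def algebra_simps)
  qed
qed

section \<open>Matrix rings\<close>

lift_definition matrix_unit :: "'n \<Rightarrow> 'n \<Rightarrow> 'a \<Rightarrow> ('a :: zero, 'n :: finite) sqmat"
  is "\<lambda>i j c. \<chi> k l. if k = i \<and> l = j then c else 0" .

lemma matrix_unit_times:
  "matrix_unit i j a * matrix_unit k l b = (if j = k then matrix_unit i l (a * b) else 0)"
  for a b :: "'a :: ring"
proof -
  have "mat_of (matrix_unit i j a * matrix_unit k l b) $ u $ v
    = mat_of (if j = k then matrix_unit i l (a * b) else 0) $ u $ v" for u v
  proof -
    have "(\<Sum>x\<in>UNIV. (if u = i \<and> x = j then a else 0) * (if x = k \<and> v = l then b else 0))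
      = (\<Sum>x\<in>UNIV. if x = j then if u = i \<and> j = k \<and> v = l then a * b else 0 else 0)"
      by (intro sum.cong) auto
    then show ?thesis
      by (simp add: times_sqmat.rep_eq matrix_unit.rep_eq zero_sqmat.rep_eq)
  qed
  then show ?thesis by (simp add: mat_of_inject[symmetric] vec_eq_iff)
qed

lemma sum_matrix_unit: "(\<Sum>i\<in>UNIV. matrix_unit i i 1) = (1 :: ('a :: {ring, monoid_mult}, 'n :: finite) sqmat)"
proof -
  have "mat_of (\<Sum>i\<in>A. matrix_unit i i 1) = (\<chi> k l. if k = l \<and> k \<in> A then (1 :: 'a) else 0)"
    if "finite A" for A :: "'n set"
    using that
    by (induction A rule: finite_induct)
      (auto simp: zero_sqmat.rep_eq plus_sqmat.rep_eq matrix_unit.rep_eq vec_eq_iff)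
  from this[of UNIV] show ?thesis
    by (simp add: mat_of_inject[symmetric] one_sqmat.rep_eq)
qed

lemma matrix_center:
  fixes z :: "('a :: {ring, monoid_mult}, 'n :: finite) sqmat"
  assumes z: "\<And>x. z * x = x * z"
  obtains \<mu> where "\<mu> \<in> ring_center" "\<And>x. z * x = smult_sqmat \<mu> x"
proof -
  have entries: "(if l = j then mat_of z $ k $ i * c else 0)
      = (if k = i then c * mat_of z $ j $ l else 0)" for i j k l c
  proof -
    have "mat_of (z * matrix_unit i j c) $ k $ l = mat_of (matrix_unit i j c * z) $ k $ l"
      by (simp only: z)
    moreover have "mat_of z $ k $ x * (if x = i \<and> l = j then c else 0)
      = (if x = i then if l = j then mat_of z $ k $ i * c else 0 else 0)"
      "(if k = i \<and> x = j then c else 0) * mat_of z $ x $ l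
      = (if x = j then if k = i then c * mat_of z $ j $ l else 0 else 0)" for x
      by auto
    ultimately show ?thesis by (simp add: times_sqmat.rep_eq matrix_unit.rep_eq)
  qed
  obtain m :: 'n where True by simp
  define \<mu> where "\<mu> = mat_of z $ m $ m"
  have diag: "mat_of z $ k $ i = (if k = i then \<mu> else 0)" for k i
    using entries[of i i k m 1] entries[of m m k i 1] entries[of i m k m 1] by (auto simp: \<mu>_def)
  show thesis
  proof (rule that)
    show "\<mu> \<in> ring_center"
      using entries[of m m m m] by (simp add: ring_center_def \<mu>_def)
    have "(\<Sum>j\<in>UNIV. (if k = j then \<mu> else 0) * mat_of x $ j $ l) = \<mu> * mat_of x $ k $ l"
      for x :: "('a, 'n) sqmat" and k l
    proof -
      have "(if k = j then \<mu> else 0) * mat_of x $ j $ l = (if k = j then \<mu> * mat_of x $ k $ l else 0)" for j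
        by auto
      then show ?thesis by simp
    qed
    then show "z * x = smult_sqmat \<mu> x" for x
      by (simp add: mat_of_inject[symmetric] times_sqmat.rep_eq smult_sqmat.rep_eq diag vec_eq_iff)
  qed
qed

theorem corollary4p5:
  fixes n :: nat
    and \<Delta> :: "('a :: {ring, monoid_mult}, 'r :: finite) sqmat \<Rightarrow> ('a, 'r) sqmat"
  assumes "n \<ge> 2"
    and "\<And>t :: 'a. t + t = 0 \<Longrightarrow> t = 0"
    and "CARD('r) \<ge> 2"
    and "mult_gen_jordan_derivation n \<Delta>"
  shows "\<exists>\<mu> \<delta>. \<mu> \<in> (ring_center :: 'a set) \<and> derivation \<delta> \<and>
           (\<forall>t. \<Delta> t = smult_sqmat \<mu> t + \<delta> t)"
proof -
  obtain i j :: 'r where ij: "i \<noteq> j"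
    using assms(3) by (metis (full_types) UNIV_I card_2_iff' card_le_Suc0_iff_eq finite
      not_less_eq_eq numeral_2_eq_2)
  define e :: "('a, 'r) sqmat" where "e = matrix_unit i i 1"
  define p :: "('a, 'r) sqmat" where "p = matrix_unit i j 1"
  define q :: "('a, 'r) sqmat" where "q = matrix_unit j i 1"
  have prods: "e * e = e" "p * e = 0" "e * q = 0" "e * p = p" "p * q = e"
    using ij by (simp_all add: e_def p_def q_def matrix_unit_times)
  have factor: "e * p * (1 - e) * q * e = e"
    by (simp add: prods right_diff_distrib)
  have torsion: "t = 0" if "t + t = 0" for t :: "('a, 'r) sqmat"
  proof -
    have "mat_of (t + t) $ k $ l = 0" for k l
      by (simp add: that zero_sqmat.rep_eq)
    then have "mat_of t $ k $ l = 0" for k l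
      by (intro assms(2)[of "mat_of t $ k $ l"]) (simp add: plus_sqmat.rep_eq)
    then show ?thesis by (simp add: mat_of_inject[symmetric] zero_sqmat.rep_eq vec_eq_iff)
  qed
  \<comment> \<open>Right multiplication by \<open>q e\<close> recovers \<open>e\<close> from \<open>e p f\<close>.\<close>
  have ann1: "t * e = 0" if "\<And>x. t * e * x * (1 - e) = 0" for t
  proof -
    have "t * e * p * (1 - e) * q * e = 0" using that[of p] by simp
    then have "t * (e * p * (1 - e) * q * e) = 0" by (simp only: mult.assoc)
    then show ?thesis by (simp only: factor)
  qed
  \<comment> \<open>The corner \<open>fRe\<close> contains \<open>f E\<^sub>k\<^sub>i\<close> for all \<open>k\<close>, and \<open>E\<^sub>k\<^sub>i E\<^sub>i\<^sub>k = E\<^sub>k\<^sub>k\<close>; the \<open>E\<^sub>k\<^sub>k\<close> sum up to \<open>1\<close>.\<close>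
  have ann2: "t * (1 - e) = 0" if t: "\<And>x. t * (1 - e) * x * e = 0" for t
  proof -
    have "t * (1 - e) * matrix_unit k k 1 = 0" for k
    proof -
      have "t * (1 - e) * matrix_unit k k 1
        = t * (1 - e) * matrix_unit k i 1 * e * matrix_unit i k 1"
        by (simp add: e_def mult.assoc matrix_unit_times)
      then show ?thesis using t by simp
    qed
    then have "t * (1 - e) * (\<Sum>k\<in>UNIV. matrix_unit k k 1) = 0"
      by (simp add: sum_distrib_left)
    then show ?thesis by (simp add: sum_matrix_unit)
  qed
  interpret peirce_ring e "1 - e"
  proof
    show "e + (1 - e) = 1" by simp
  qed (fact prods(1) torsion ann1 ann2)+
  obtain z d where z: "\<And>x. z * x = x * z" and d: "derivation d" and \<Delta>: "\<And>x. \<Delta> x = z * x + d x"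
    using mult_gen_jordan_derivation_structure[OF factor assms(4,1)] by blast
  obtain \<mu> where "\<mu> \<in> ring_center" "\<And>x. z * x = smult_sqmat \<mu> x"
    using matrix_center[OF z] by blast
  with d \<Delta> show ?thesis by auto
qed

end
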